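(* Let $N$ be an odd positive integer, let $b\in\mathbb{R}$ with $|b|<2$, put $\theta=\arccos(-\tfrac b2)$, and assume that $N\theta$ is a multiple of $2\pi$. Let $g:\mathbb{Z}^+\times\mathbb{R}\to\mathbb{R}$ be continuous. Suppose the following conditions hold: (C1) $g$ is $N$-periodic in its first variable $t$ and bounded by a constant $K$, that is, $|g(t,x)|\leq K$ for all $t\in\mathbb{Z}^+$ and $x\in\mathbb{R}$; (C2) there exist constants $\hat z$ and $J>0$ such that for all $x\in\mathbb{R}$ with $x\geq\hat z$ and for every $t\in\mathbb{Z}^+$, $g(t,-x)\leq -J<0<J\leq g(t,x)$; (C3) writing $N\theta=2\pi r$ with $r$ an integer, and with $K$ and $J$ the constants above, $\dfrac{N}{\gcd(r,N)}\geq\max\left\{3,\dfrac KJ+1\right\}$. Then the equation $$y(t+2)+b\,y(t+1)+y(t)=g(t,y(t)),\qquad t\in\mathbb{Z}^+,$$ has an $N$-periodic solution $y:\mathbb{Z}^+\to\mathbb{R}$.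
   Context: $\mathbb{Z}^+$ denotes the nonnegative integers $\{0,1,2,\dots\}$. A function $\phi$ on $\mathbb{Z}^+$ is $N$-periodic if $\phi(t+N)=\phi(t)$ for all $t\in\mathbb{Z}^+$. $\gcd(r,N)$ is the greatest common divisor of $r$ and $N$. *)

theory Defs
  imports Complex_Main
begin

definition n_periodic :: "nat \<Rightarrow> (nat \<Rightarrow> 'a) \<Rightarrow> bool" where
  "n_periodic N \<phi> \<longleftrightarrow> (\<forall>t. \<phi> (t + N) = \<phi> t)"

end

theory Submission
  imports Defs "HOL-Analysis.Brouwer_Fixpoint"
begin

text \<open>
  The kernel of \<open>y \<mapsto> y(t+2) + b y(t+1) + y(t)\<close> consists of the functions
  \<open>Re (c cis (- \<theta> t))\<close>, and all of them are \<open>N\<close>-periodic. By variation of constants every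
  solution is \<open>y(t) = Re (a(t) cis (- \<theta> t))\<close> with a complex amplitude \<open>a\<close> starting at
  \<open>a(0) = c\<close>, and it is \<open>N\<close>-periodic as soon as \<open>F(c) = (\<Sum>s<N. g(s, y(s)) cis (\<theta> s))\<close>
  vanishes. Since \<open>a\<close> stays within a bounded distance of \<open>c\<close> up to time \<open>N\<close>, the sign condition
  on \<open>g\<close> makes the inner product of \<open>c\<close> and \<open>F(c)\<close> positive on a large circle, so Brouwer's
  theorem in the plane yields a zero of \<open>F\<close>.
\<close>

text \<open>If \<open>F\<close> had no zero, \<open>h\<close> would rescale \<open>- F\<close> to
  length \<open>R\<close> and map the ball into its boundary sphere. A Brouwer fixed point of
  \<open>h\<close> would then lie on the sphere with \<open>F\<close> pointing inward there.\<close>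

lemma zero_in_cball_if_outward:
  fixes F :: "'a::euclidean_space \<Rightarrow> 'a"
  assumes R: "R > 0" and cont: "continuous_on (cball 0 R) F"
    and outward: "\<And>x. norm x = R \<Longrightarrow> inner x (F x) > 0"
  shows "\<exists>x\<in>cball 0 R. F x = 0"
proof (rule ccontr)
  assume "\<not> ?thesis"
  then have nz: "\<And>x. x \<in> cball 0 R \<Longrightarrow> F x \<noteq> 0" by blast
  define h where "h x = - (R / norm (F x)) *\<^sub>R F x" for x
  have norm_h: "norm (h x) = R" if "x \<in> cball 0 R" for x
    using nz[OF that] R by (simp add: h_def)
  have "continuous_on (cball 0 R) h"
    unfolding h_def using nz by (intro continuous_intros cont) auto
  moreover have "h \<in> cball 0 R \<rightarrow> cball 0 R"
    using norm_h by (auto simp del: norm_le_zero_iff)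
  ultimately obtain x where x: "x \<in> cball 0 R" "h x = x"
    using brouwer[of "cball 0 R" h] R by auto
  have "inner x (F x) > 0"
    using outward norm_h[OF x(1)] x(2) by simp
  moreover have "inner (h x) (F x) = - (R * norm (F x))"
    using nz[OF x(1)] by (simp add: h_def dot_square_norm power2_eq_square)
  ultimately show False
    using x(2) R by (simp add: mult_less_0_iff not_less)
qed

text \<open>The factor of \<open>g\<close> is the amplitude of the kernel function that is 0 at time
  \<open>t + 1\<close> and 1 at time \<open>t + 2\<close>, so the forcing at time \<open>t\<close>
  enters the equation exactly once.\<close>

primrec amplitude :: "(nat \<Rightarrow> real \<Rightarrow> real) \<Rightarrow> real \<Rightarrow> complex \<Rightarrow> nat \<Rightarrow> complex" where
  "amplitude g \<theta> c 0 = c"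
| "amplitude g \<theta> c (Suc t) = amplitude g \<theta> c t +
     \<i> * cis (\<theta> * Suc t) / of_real (sin \<theta>) * g t (Re (amplitude g \<theta> c t * cis (- \<theta> * t)))"

definition solution :: "(nat \<Rightarrow> real \<Rightarrow> real) \<Rightarrow> real \<Rightarrow> complex \<Rightarrow> nat \<Rightarrow> real" where
  "solution g \<theta> c t = Re (amplitude g \<theta> c t * cis (- \<theta> * t))"

lemma amplitude_Suc:
  "amplitude g \<theta> c (Suc t) =
     amplitude g \<theta> c t + \<i> * cis (\<theta> * Suc t) / of_real (sin \<theta>) * g t (solution g \<theta> c t)"
  by (simp add: solution_def)

lemma solution_recurrence:
  assumes s: "sin \<theta> \<noteq> 0"
  shows "solution g \<theta> c (t + 2) - 2 * cos \<theta> * solution g \<theta> c (t + 1) + solution g \<theta> c t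
    = g t (solution g \<theta> c t)"
proof -
  define a where "a = amplitude g \<theta> c"
  define y where "y = solution g \<theta> c"
  define q where "q = \<i> / complex_of_real (sin \<theta>)"
  define e where "e = cis (- \<theta>)"
  \<comment> \<open>In the rotating frame the recursion is first order with constant coefficients:
    multiply by \<open>e\<close>, then add \<open>q\<close> times the forcing.\<close>
  have a_rotated: "a (Suc t) * cis (- \<theta> * Suc t) = a t * cis (- \<theta> * t) * e + q * g t (y t)" for t
  proof -
    have "a (Suc t) * cis (- \<theta> * Suc t) = a t * cis (- \<theta> * Suc t)
        + q * (cis (\<theta> * Suc t) * cis (- \<theta> * Suc t)) * g t (y t)"
      unfolding a_def y_def q_def amplitude_Suc by (simp add: algebra_simps)
    moreover have "cis (\<theta> * Suc t) * cis (- \<theta> * Suc t) = 1"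
      by (simp add: cis_mult)
    moreover have "cis (- \<theta> * Suc t) = cis (- \<theta> * t) * e"
      by (simp add: e_def cis_mult algebra_simps)
    ultimately show ?thesis by (simp only: mult.assoc mult_1_right) simp
  qed
  define x where "x = a t * cis (- \<theta> * t)"
  have Re_q: "Re q = 0" and Re_qe: "Re (q * e) = 1"
    using s by (auto simp: q_def e_def Re_divide power2_eq_square)
  have y0: "y t = Re x" by (simp add: y_def solution_def x_def a_def)
  have y1: "y (t + 1) = Re (x * e)"
    using arg_cong[OF a_rotated[of t], of Re] Re_q
    by (simp add: y_def solution_def x_def a_def)
  have "a (t + 2) * cis (- \<theta> * (t + 2)) = (x * e + q * g t (y t)) * e + q * g (Suc t) (y (Suc t))"
    using a_rotated[of "Suc t"] a_rotated[of t] by (simp add: x_def)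
  then have "y (t + 2) = Re (x * e * e + (q * e) * g t (y t) + q * g (Suc t) (y (Suc t)))"
    by (simp add: y_def solution_def a_def algebra_simps)
  then have y2: "y (t + 2) = Re (x * e * e) + g t (y t)"
    using Re_q Re_qe by (simp only: plus_complex.simps Re_complex_of_real times_complex.simps) simp
  \<comment> \<open>\<open>e\<close> is a root of the characteristic polynomial, so the homogeneous
    part cancels.\<close>
  have "e * e - 2 * cos \<theta> * e + 1 = 0"
    using sin_cos_squared_add3[of \<theta>]
    by (simp add: e_def complex_eq_iff algebra_simps)
  then have "Re (x * (e * e - 2 * cos \<theta> * e + 1)) = 0" by simp
  then have "Re (x * e * e) - 2 * cos \<theta> * Re (x * e) + Re x = 0"
    by (simp add: algebra_simps)
  then show ?thesis using y0 y1 y2 by (simp add: y_def)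
qed

lemma continuous_on_amplitude:
  assumes "\<And>t. continuous_on UNIV (g t)"
  shows "continuous_on UNIV (\<lambda>c. amplitude g \<theta> c t)"
proof (induction t)
  case (Suc t)
  have "continuous_on UNIV (\<lambda>c. g t (Re (amplitude g \<theta> c t * cis (- \<theta> * t))))"
    by (rule continuous_on_compose2[OF assms]) (auto intro!: continuous_intros Suc.IH)
  then show ?case by (auto intro!: continuous_intros Suc.IH simp: divide_inverse)
qed simp

lemma continuous_on_solution:
  assumes "\<And>t. continuous_on UNIV (g t)"
  shows "continuous_on UNIV (\<lambda>c. solution g \<theta> c t)"
  unfolding solution_def by (intro continuous_intros continuous_on_amplitude assms)

lemma amplitude_eq_sum:
  "amplitude g \<theta> c t = c + \<i> * cis \<theta> / of_real (sin \<theta>) * (\<Sum>s<t. g s (solution g \<theta> c s) * cis (\<theta> * s))"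
proof (induction t)
  case (Suc t)
  have "cis (\<theta> * Suc t) = cis \<theta> * cis (\<theta> * t)"
    by (simp add: cis_mult algebra_simps)
  then show ?case
    unfolding amplitude_Suc Suc.IH by (simp add: algebra_simps)
qed simp

text \<open>The bound is uniform in \<open>c\<close>, so for large \<open>c\<close> the solution is
  a small relative perturbation of a kernel function.\<close>

lemma amplitude_dist:
  assumes bound: "\<And>t x. \<bar>g t x\<bar> \<le> K" and s: "sin \<theta> > 0"
  shows "norm (amplitude g \<theta> c t - c) \<le> t * K / sin \<theta>"
proof -
  have "norm (\<Sum>s<t. g s (solution g \<theta> c s) * cis (\<theta> * s)) \<le> (\<Sum>s<t. K)"
    by (rule sum_norm_le) (simp add: norm_mult bound)
  then show ?thesis
    using s by (simp add: amplitude_eq_sum norm_mult norm_divide divide_right_mono)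
qed

text \<open>The vanishing sum says that the amplitude is back at \<open>c\<close> after
  \<open>N\<close> steps; from there its increments repeat, as \<open>g\<close> and the rotation are
  \<open>N\<close>-periodic.\<close>

lemma solution_periodic:
  assumes N: "cis (\<theta> * N) = 1" and g: "\<And>x. n_periodic N (\<lambda>t. g t x)"
    and sum: "(\<Sum>s<N. g s (solution g \<theta> c s) * cis (\<theta> * s)) = 0"
  shows "n_periodic N (solution g \<theta> c)"
proof -
  have cis_shift: "cis (\<theta> * real (t + N)) = cis (\<theta> * t)" for t
    using N by (simp add: distrib_left flip: cis_mult)
  have cis_shift': "cis (- \<theta> * real (t + N)) = cis (- \<theta> * t)" for t
    using arg_cong[OF cis_shift[of t], of cnj] by (simp add: cis_cnj)
  have g_shift: "g (t + N) x = g t x" for t x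
    using g by (simp add: n_periodic_def)
  have "amplitude g \<theta> c (t + N) = amplitude g \<theta> c t" for t
  proof (induction t)
    case 0
    then show ?case by (simp add: amplitude_eq_sum sum)
  next
    case (Suc t)
    then have "solution g \<theta> c (t + N) = solution g \<theta> c t"
      by (simp only: solution_def cis_shift')
    then show ?case
      using Suc cis_shift[of "Suc t"] by (simp only: add_Suc amplitude_Suc g_shift)
  qed
  then show ?thesis by (simp only: n_periodic_def solution_def cis_shift') simp
qed

text \<open>Here \<open>u\<close> is a kernel value and \<open>y\<close> the nearby solution value.
  If \<open>u\<close> exceeds \<bar>z\<bar> + C in absolute value, then \<open>y\<close> is past the
  threshold on the same side and \<open>g y\<close> has the sign of \<open>u\<close>. Otherwise the
  crude bound by \<open>K\<close> loses at most \<open>(K + J) * \<bar>u\<bar>\<close>, which the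
  constant absorbs.\<close>

lemma sign_condition_lower_bound:
  fixes g :: "real \<Rightarrow> real"
  assumes bound: "\<And>x. \<bar>g x\<bar> \<le> K" and "J > 0"
    and sign: "\<And>x. x \<ge> z \<Longrightarrow> g (- x) \<le> - J \<and> J \<le> g x"
    and close: "\<bar>y - u\<bar> \<le> C"
  shows "g y * u \<ge> J * \<bar>u\<bar> - (K + J) * (\<bar>z\<bar> + C)"
proof -
  have K: "K \<ge> 0" and C: "C \<ge> 0"
    using bound[of 0] close by linarith+
  consider "\<bar>u\<bar> \<le> \<bar>z\<bar> + C" | "u > \<bar>z\<bar> + C" | "- u > \<bar>z\<bar> + C" by linarith
  then show ?thesis
  proof cases
    case 1
    have "\<bar>g y * u\<bar> \<le> K * \<bar>u\<bar>"
      by (simp add: abs_mult bound mult_right_mono)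
    moreover have "(K + J) * \<bar>u\<bar> \<le> (K + J) * (\<bar>z\<bar> + C)"
      using 1 K \<open>J > 0\<close> by (intro mult_left_mono) auto
    ultimately show ?thesis by (simp add: distrib_right)
  next
    case 2
    then have "g y \<ge> J" using sign[of y] close by linarith
    then have "g y * u \<ge> J * \<bar>u\<bar>" using 2 C by (simp add: mult_right_mono)
    moreover have "(K + J) * (\<bar>z\<bar> + C) \<ge> 0" using K C \<open>J > 0\<close> by simp
    ultimately show ?thesis by linarith
  next
    case 3
    then have "g y \<le> - J" using sign[of "- y"] close by auto
    then have "- g y * - u \<ge> J * - u" using 3 C by (intro mult_right_mono) auto
    moreover have "(K + J) * (\<bar>z\<bar> + C) \<ge> 0" using K C \<open>J > 0\<close> by simp
    ultimately show ?thesis using 3 C by simp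
  qed
qed

text \<open>The values at times 0 and 1 already determine \<open>c\<close>: the first is
  \<open>Re c\<close>, and the second gives \<open>Im c * sin \<theta>\<close> up to an error of at
  most \<open>\<bar>Re c\<bar>\<close>.\<close>

lemma kernel_l1_lower_bound:
  assumes N: "N \<ge> 2" and s: "sin \<theta> \<ge> 0"
  shows "norm c * sin \<theta> \<le> 2 * (\<Sum>t<N. \<bar>Re (c * cis (- \<theta> * real t))\<bar>)"
proof -
  define u where "u t = Re (c * cis (- \<theta> * real t))" for t
  have u0: "u 0 = Re c" and u1: "u 1 = Re c * cos \<theta> + Im c * sin \<theta>"
    by (auto simp: u_def)
  have "norm c * sin \<theta> \<le> (\<bar>Re c\<bar> + \<bar>Im c\<bar>) * sin \<theta>"
    using s cmod_le by (intro mult_right_mono) auto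
  also have "\<dots> \<le> \<bar>Re c\<bar> + \<bar>Im c * sin \<theta>\<bar>"
    using s by (simp add: distrib_right abs_mult mult_left_le)
  also have "\<bar>Im c * sin \<theta>\<bar> \<le> \<bar>u 1\<bar> + \<bar>Re c * cos \<theta>\<bar>"
    using u1 by linarith
  also have "\<bar>Re c * cos \<theta>\<bar> \<le> \<bar>Re c\<bar>"
    by (simp add: abs_mult mult_left_le)
  also have "\<bar>Re c\<bar> + (\<bar>u 1\<bar> + \<bar>Re c\<bar>) \<le> 2 * (\<Sum>t\<in>{0, 1}. \<bar>u t\<bar>)"
    using u0 by simp
  also have "(\<Sum>t\<in>{0, 1}. \<bar>u t\<bar>) \<le> (\<Sum>t<N. \<bar>u t\<bar>)"
    using N by (intro sum_mono2) auto
  finally show ?thesis by (simp add: u_def)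
qed

theorem theorem4p1:
  fixes N :: nat and b \<theta> K J z :: real and r :: int
    and g :: "nat \<Rightarrow> real \<Rightarrow> real"
  assumes "N > 0" and "odd N"
    and "\<bar>b\<bar> < 2"
    and "\<theta> = arccos (- (b / 2))"
    and "real N * \<theta> = 2 * pi * real_of_int r"
    and "continuous_on UNIV (\<lambda>p :: nat \<times> real. g (fst p) (snd p))"
    and "\<forall>x. n_periodic N (\<lambda>t. g t x)"
    and "\<forall>t x. \<bar>g t x\<bar> \<le> K"
    and "J > 0"
    and "\<forall>x t. x \<ge> z \<longrightarrow> g t (- x) \<le> - J \<and> - J < 0 \<and> 0 < J \<and> J \<le> g t x"
    and "real N / real_of_int (gcd r (int N)) \<ge> max 3 (K / J + 1)"
  shows "\<exists>y :: nat \<Rightarrow> real. n_periodic N y \<and>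
           (\<forall>t. y (t + 2) + b * y (t + 1) + y t = g t (y t))"
proof -
  have cont: "continuous_on UNIV (g t)" for t
    using continuous_on_compose2[OF assms(6), of UNIV "\<lambda>x. (t, x)"]
    by (simp add: continuous_on_Pair)
  have bound: "\<bar>g t x\<bar> \<le> K" for t x using assms(8) by blast
  have K: "K \<ge> 0" using bound[of 0 0] by linarith
  have b: "cos \<theta> = - (b / 2)"
    using assms(3,4) by (simp add: cos_arccos_abs)
  have "0 < \<theta>" "\<theta> < pi"
    using arccos_lt_bounded[of "- (b / 2)"] assms(3,4) by auto
  then have s: "sin \<theta> > 0" by (rule sin_gt_zero)
  have cis_N: "cis (\<theta> * N) = 1"
    using assms(5) cis_multiple_2pi[of "real_of_int r"] by (simp add: mult.commute)
  \<comment> \<open>For \<open>N = 1\<close> the quotient of \<open>N\<close> by the gcd is 1, which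
    is below 3.\<close>
  have N: "N \<ge> 2"
  proof (rule ccontr)
    assume "\<not> N \<ge> 2"
    then have "N = 1" using assms(1) by simp
    then show False using assms(11) by simp
  qed
  \<comment> \<open>\<open>C\<close> bounds the drift of the amplitude over one period, and
    \<open>D\<close> the loss per time step in the sign estimate. \<open>R\<close> makes
    \<open>J * R * sin \<theta>\<close> exceed the doubled total loss \<open>2 * N * D\<close>; the
    summand 1 makes this strict.\<close>
  define C where "C = N * K / sin \<theta>"
  define D where "D = (K + J) * (\<bar>z\<bar> + C)"
  define R where "R = 2 * N * D / (J * sin \<theta>) + 1"
  define F where "F c = (\<Sum>t<N. g t (solution g \<theta> c t) * cis (\<theta> * t))" for c
  have "C \<ge> 0" using K s by (simp add: C_def)
  then have "R > 0" using K s assms(9) by (simp add: R_def D_def add_nonneg_pos)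
  have close: "\<bar>solution g \<theta> c t - Re (c * cis (- \<theta> * t))\<bar> \<le> C" if "t < N" for c t
  proof -
    have "\<bar>solution g \<theta> c t - Re (c * cis (- \<theta> * t))\<bar> \<le> norm ((amplitude g \<theta> c t - c) * cis (- \<theta> * t))"
      unfolding solution_def minus_complex.simps(1)[symmetric] left_diff_distrib[symmetric]
      by (rule abs_Re_le_cmod)
    also have "\<dots> \<le> t * K / sin \<theta>"
      using amplitude_dist[OF bound s] by (simp add: norm_mult)
    also have "\<dots> \<le> C"
      unfolding C_def using that s K by (intro divide_right_mono mult_right_mono) auto
    finally show ?thesis .
  qed
  have outward: "inner c (F c) > 0" if c: "norm c = R" for c
  proof -
    define u where "u t = Re (c * cis (- \<theta> * real t))" for t
    have "2 * N * D < J * (R * sin \<theta>)"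
      using s assms(9) by (simp add: R_def field_simps)
    also have "\<dots> \<le> J * (2 * (\<Sum>t<N. \<bar>u t\<bar>))"
      using kernel_l1_lower_bound[OF N, of \<theta> c] s assms(9) c
      by (intro mult_left_mono) (auto simp: u_def)
    finally have "0 < (\<Sum>t<N. J * \<bar>u t\<bar> - D)"
      by (simp add: sum_subtractf flip: sum_distrib_left)
    also have "\<dots> \<le> (\<Sum>t<N. g t (solution g \<theta> c t) * u t)"
      unfolding D_def using bound assms(9,10) close
      by (intro sum_mono sign_condition_lower_bound) (auto simp: u_def)
    \<comment> \<open>The kernel value \<open>u t\<close> is the real inner product of
      \<open>c\<close> with \<open>cis (\<theta> * t)\<close>.\<close>
    also have "\<dots> = inner c (F c)"
      unfolding F_def inner_sum_right
      by (intro sum.cong) (auto simp: u_def inner_complex_def algebra_simps)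
    finally show ?thesis .
  qed
  have "continuous_on (cball 0 R) F"
    unfolding F_def
    by (intro continuous_intros continuous_on_compose2[OF cont]
        continuous_on_subset[OF continuous_on_solution[OF cont]]) auto
  then obtain c where "F c = 0"
    using zero_in_cball_if_outward[OF \<open>R > 0\<close> _ outward] by blast
  then have "n_periodic N (solution g \<theta> c)"
    using solution_periodic[OF cis_N] assms(7) by (simp add: F_def)
  moreover have "\<forall>t. solution g \<theta> c (t + 2) + b * solution g \<theta> c (t + 1) + solution g \<theta> c t
      = g t (solution g \<theta> c t)"
    using solution_recurrence[of \<theta> g c] s b by simp
  ultimately show ?thesis by blast
qed

end
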